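(* Fix $n\ge1$, positive numbers $p_1,\dots,p_n>0$ and nonempty finite sets $S_1,\dots,S_n\subset\mathbb{Z}$. The inequality $$\sum_{z\in\mathbb{Z}^d}\max_{x^{(1)}+\dots+x^{(n)}=z}\prod_{j=1}^n f_j^{p_j}(x^{(j)})\ \geq\ \prod_{j=1}^n\left(\sum_{x\in\mathbb{Z}^d} f_j(x)\right)^{p_j}$$ holds for all $d\ge1$ and all non-negative functions $f_j:\mathbb{Z}^d\to[0,\infty)$ supported on $S_j^d$ ($j=1,\dots,n$) if and only if it holds for $d=1$ (for all non-negative $f_j:\mathbb{Z}\to[0,\infty)$ supported on $S_j$).
   Context: The maximum is over all $x^{(1)},\dots,x^{(n)}\in\mathbb{Z}^d$ with $x^{(1)}+\dots+x^{(n)}=z$. *)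

theory Defs
  imports "HOL-Analysis.Infinite_Sum" "HOL-Library.Function_Algebras"
begin

(* The dimension d is quantified inside the statement, so Z^d is a subset of a fixed type:
   the integer sequences vanishing from position d on.  Addition is the pointwise addition
   of Function_Algebras, under which int_lattice d is a subgroup. *)
definition int_lattice :: "nat \<Rightarrow> (nat \<Rightarrow> int) set" where
  "int_lattice d = {x. \<forall>i\<ge>d. x i = 0}"

definition cartesian_power :: "int set \<Rightarrow> nat \<Rightarrow> (nat \<Rightarrow> int) set" where
  "cartesian_power T d = {x \<in> int_lattice d. \<forall>i<d. x i \<in> T}"

definition product_values ::
  "'a::comm_monoid_add set \<Rightarrow> nat \<Rightarrow> (nat \<Rightarrow> real) \<Rightarrow> (nat \<Rightarrow> 'a \<Rightarrow> real) \<Rightarrow> 'a \<Rightarrow> real set" where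
  "product_values G n p f z =
     {\<Prod>j=1..n. f j (x j) powr p j | x. (\<forall>j\<in>{1..n}. x j \<in> G) \<and> (\<Sum>j=1..n. x j) = z}"

(* G is the ambient group: int_lattice d for Z^d, or UNIV :: int set for Z itself.
   Only the values of f on G matter.  Max and infsum are total functions; they carry their
   intended meaning here because the functions involved have finite support, see
   product_values_finite_nonempty and finite_support_Max below. *)
definition sup_convolution_ineq ::
  "'a::comm_monoid_add set \<Rightarrow> nat \<Rightarrow> (nat \<Rightarrow> real) \<Rightarrow> (nat \<Rightarrow> 'a \<Rightarrow> real) \<Rightarrow> bool" where
  "sup_convolution_ineq G n p f \<longleftrightarrow>
     (\<Sum>\<^sub>\<infinity>z\<in>G. Max (product_values G n p f z)) \<ge> (\<Prod>j=1..n. (\<Sum>\<^sub>\<infinity>x\<in>G. f j x) powr p j)"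

definition nonneg_supported_on :: "'a set \<Rightarrow> 'a set \<Rightarrow> ('a \<Rightarrow> real) \<Rightarrow> bool" where
  "nonneg_supported_on G T g \<longleftrightarrow> (\<forall>x\<in>G. g x \<ge> 0) \<and> (\<forall>x\<in>G. g x \<noteq> 0 \<longrightarrow> x \<in> T)"

lemma finite_cartesian_power:
  assumes "finite T" shows "finite (cartesian_power T d)"
proof -
  have "inj_on (\<lambda>x. restrict x {..<d}) (cartesian_power T d)"
  proof (rule inj_onI)
    fix x y assume xy: "x \<in> cartesian_power T d" "y \<in> cartesian_power T d"
      and eq: "restrict x {..<d} = restrict y {..<d}"
    show "x = y"
    proof
      fix i
      show "x i = y i"
      proof (cases "i < d")
        case True
        then show ?thesis using fun_cong[OF eq, of i] by simp
      next
        case False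
        then show ?thesis using xy by (simp add: cartesian_power_def int_lattice_def)
      qed
    qed
  qed
  moreover have "(\<lambda>x. restrict x {..<d}) ` cartesian_power T d \<subseteq> PiE {..<d} (\<lambda>_. T)"
    by (auto simp: cartesian_power_def PiE_def Pi_def extensional_def)
  moreover have "finite (PiE {..<d} (\<lambda>_. T))"
    using assms by (intro finite_PiE) auto
  ultimately show ?thesis by (meson finite_imageD finite_subset)
qed

lemma product_values_finite_nonempty:
  fixes G :: "'a::comm_monoid_add set"
  assumes n: "n \<ge> 1" and z: "z \<in> G" and G0: "0 \<in> G"
    and T: "\<And>j. j \<in> {1..n} \<Longrightarrow> finite (T j)"
    and f: "\<And>j. j \<in> {1..n} \<Longrightarrow> nonneg_supported_on G (T j) (f j)"
  shows "finite (product_values G n p f z)" "product_values G n p f z \<noteq> {}"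
proof -
  let ?V = "\<lambda>j. insert 0 (f j ` T j)"
  have "product_values G n p f z \<subseteq> (\<lambda>v. \<Prod>j=1..n. v j powr p j) ` PiE {1..n} ?V"
  proof
    fix r assume "r \<in> product_values G n p f z"
    then obtain x where x: "\<forall>j\<in>{1..n}. x j \<in> G" "r = (\<Prod>j=1..n. f j (x j) powr p j)"
      by (auto simp: product_values_def)
    have "restrict (\<lambda>j. f j (x j)) {1..n} \<in> PiE {1..n} ?V"
      using x(1) f by (auto simp: nonneg_supported_on_def)
    moreover have "r = (\<Prod>j=1..n. restrict (\<lambda>j. f j (x j)) {1..n} j powr p j)"
      using x(2) by (auto intro: prod.cong)
    ultimately show "r \<in> (\<lambda>v. \<Prod>j=1..n. v j powr p j) ` PiE {1..n} ?V" by blast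
  qed
  moreover have "finite (PiE {1..n} ?V)" using T by (intro finite_PiE) auto
  ultimately show "finite (product_values G n p f z)" by (meson finite_imageI finite_subset)
  let ?x = "\<lambda>j. if j = 1 then z else 0"
  have "(\<Sum>j=1..n. ?x j) = z" using n by (simp add: sum.delta)
  moreover have "\<forall>j\<in>{1..n}. ?x j \<in> G" using z G0 by simp
  ultimately have "(\<Prod>j=1..n. f j (?x j) powr p j) \<in> product_values G n p f z"
    unfolding product_values_def by (intro CollectI exI[of _ ?x]) simp
  then show "product_values G n p f z \<noteq> {}" by blast
qed

lemma finite_support_Max:
  fixes G :: "'a::comm_monoid_add set"
  assumes n: "n \<ge> 1" and G0: "0 \<in> G"
    and T: "\<And>j. j \<in> {1..n} \<Longrightarrow> finite (T j)"
    and f: "\<And>j. j \<in> {1..n} \<Longrightarrow> nonneg_supported_on G (T j) (f j)"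
  shows "finite {z \<in> G. Max (product_values G n p f z) \<noteq> 0}"
proof -
  have "{z \<in> G. Max (product_values G n p f z) \<noteq> 0} \<subseteq> (\<lambda>x. \<Sum>j=1..n. x j) ` PiE {1..n} T"
  proof
    fix z assume "z \<in> {z \<in> G. Max (product_values G n p f z) \<noteq> 0}"
    then have z: "z \<in> G" "Max (product_values G n p f z) \<noteq> 0" by auto
    have "Max (product_values G n p f z) \<in> product_values G n p f z"
      using product_values_finite_nonempty[OF n z(1) G0 T f, where p = p] by (intro Max_in) auto
    then obtain x where x: "\<forall>j\<in>{1..n}. x j \<in> G" "(\<Sum>j=1..n. x j) = z"
        "Max (product_values G n p f z) = (\<Prod>j=1..n. f j (x j) powr p j)"
      by (auto simp: product_values_def)
    have "f j (x j) \<noteq> 0" if "j \<in> {1..n}" for j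
    proof
      assume "f j (x j) = 0"
      then have "(\<Prod>j=1..n. f j (x j) powr p j) = 0"
        using that by (intro prod_zero) auto
      then show False using z x(3) by simp
    qed
    then have "x j \<in> T j" if "j \<in> {1..n}" for j
      using f[OF that] x(1) that by (auto simp: nonneg_supported_on_def)
    then have "restrict x {1..n} \<in> PiE {1..n} T" by auto
    moreover have "z = (\<Sum>j=1..n. restrict x {1..n} j)" using x(2) by (auto intro: sum.cong)
    ultimately show "z \<in> (\<lambda>x. \<Sum>j=1..n. x j) ` PiE {1..n} T" by blast
  qed
  moreover have "finite (PiE {1..n} T)" using T by (intro finite_PiE) auto
  ultimately show ?thesis by (meson finite_imageI finite_subset)
qed

end

(* The argument is the induction behind the Prekopa-Leindler inequality: if the inequality holds
   on G and on H, it holds on G x H, by applying it on H to the sections f_j(t_j, .) and then on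
   G to their total masses.  Since Z^(d+1) is Z x Z^d and the case d = 0 is trivial, the case
   d = 1 gives all d. *)

theory Submission
  imports Defs "HOL-Library.Product_Plus"
begin

text \<open>The support sets are fixed and the functions quantified, which is the property carried
  through the induction. The type is arbitrary so that \<int>, \<open>int_lattice d\<close> and
  products of the two are all instances.\<close>

definition sup_convolution_ineq_on ::
  "'a::comm_monoid_add set \<Rightarrow> nat \<Rightarrow> (nat \<Rightarrow> real) \<Rightarrow> (nat \<Rightarrow> 'a set) \<Rightarrow> bool" where
  "sup_convolution_ineq_on G n p T \<longleftrightarrow>
     (\<forall>f. (\<forall>j\<in>{1..n}. nonneg_supported_on G (T j) (f j)) \<longrightarrow> sup_convolution_ineq G n p f)"

text \<open>An additive bijection matches the decompositions of \<open>z\<close> with those of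
  \<open>\<phi> z\<close>, so both sides of the inequality for \<open>f\<close> on \<open>K\<close>
  equal those for \<open>f j \<circ> \<phi>\<close> on \<open>G\<close>. The condition on
  \<open>T\<close> and \<open>U\<close> makes the pulled-back functions admissible on
  \<open>G\<close>.\<close>

lemma sup_convolution_ineq_on_bij:
  fixes \<phi> :: "'a::comm_monoid_add \<Rightarrow> 'b::comm_monoid_add"
  assumes bij: "bij_betw \<phi> G K"
    and zero: "\<phi> 0 = 0" and add: "\<And>x y. \<phi> (x + y) = \<phi> x + \<phi> y"
    and closed: "0 \<in> G" "\<And>x y. x \<in> G \<Longrightarrow> y \<in> G \<Longrightarrow> x + y \<in> G"
    and T: "\<And>j x. j \<in> {1..n} \<Longrightarrow> x \<in> G \<Longrightarrow> \<phi> x \<in> U j \<Longrightarrow> x \<in> T j"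
    and G: "sup_convolution_ineq_on G n p T"
  shows "sup_convolution_ineq_on K n p U"
  unfolding sup_convolution_ineq_on_def
proof (intro allI impI)
  fix f :: "nat \<Rightarrow> 'b \<Rightarrow> real"
  assume f: "\<forall>j\<in>{1..n}. nonneg_supported_on K (U j) (f j)"
  let ?g = "\<lambda>j x. f j (\<phi> x)"
  have \<phi>_in: "\<phi> x \<in> K" if "x \<in> G" for x
    using bij that by (auto simp: bij_betw_def)
  have \<phi>_sum: "\<phi> (\<Sum>j\<in>A. x j) = (\<Sum>j\<in>A. \<phi> (x j))" for A :: "nat set" and x
    by (induction A rule: infinite_finite_induct) (simp_all add: zero add)
  have sum_in: "(\<Sum>j\<in>A. x j) \<in> G" if "\<forall>j\<in>A. x j \<in> G" for A :: "nat set" and x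
    using that by (induction A rule: infinite_finite_induct) (auto intro: closed)
  have "\<forall>j\<in>{1..n}. nonneg_supported_on G (T j) (?g j)"
    using f T \<phi>_in unfolding nonneg_supported_on_def by blast
  then have "sup_convolution_ineq G n p ?g"
    using G unfolding sup_convolution_ineq_on_def by simp
  then have ineq: "(\<Prod>j=1..n. (\<Sum>\<^sub>\<infinity>x\<in>G. f j (\<phi> x)) powr p j)
      \<le> (\<Sum>\<^sub>\<infinity>z\<in>G. Max (product_values G n p ?g z))"
    unfolding sup_convolution_ineq_def .
  have "product_values G n p ?g z = product_values K n p f (\<phi> z)" if z: "z \<in> G" for z
  proof (intro equalityI subsetI)
    fix r assume "r \<in> product_values G n p ?g z"
    then obtain x where x: "\<forall>j\<in>{1..n}. x j \<in> G" "(\<Sum>j=1..n. x j) = z"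
        "r = (\<Prod>j=1..n. f j (\<phi> (x j)) powr p j)"
      unfolding product_values_def by blast
    then show "r \<in> product_values K n p f (\<phi> z)"
      unfolding product_values_def
      by (intro CollectI exI[of _ "\<lambda>j. \<phi> (x j)"]) (auto simp: \<phi>_sum \<phi>_in)
  next
    fix r assume "r \<in> product_values K n p f (\<phi> z)"
    then obtain y where y: "\<forall>j\<in>{1..n}. y j \<in> K" "(\<Sum>j=1..n. y j) = \<phi> z"
        "r = (\<Prod>j=1..n. f j (y j) powr p j)"
      unfolding product_values_def by blast
    have "\<forall>j\<in>{1..n}. \<exists>x\<in>G. \<phi> x = y j"
      using y(1) bij by (force simp: bij_betw_def)
    then obtain x where x: "\<forall>j\<in>{1..n}. x j \<in> G \<and> \<phi> (x j) = y j"
      by metis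
    then have "\<phi> (\<Sum>j=1..n. x j) = \<phi> z"
      using y(2) by (simp add: \<phi>_sum)
    \<comment> \<open>\<phi> is injective only on \<open>G\<close>, so the sum of the preimages must
      be placed in \<open>G\<close> before \<phi> can be cancelled.\<close>
    moreover have "(\<Sum>j=1..n. x j) \<in> G"
      using x by (intro sum_in) auto
    ultimately have "(\<Sum>j=1..n. x j) = z"
      using bij z by (auto simp: bij_betw_def inj_on_def)
    with x y(3) show "r \<in> product_values G n p ?g z"
      unfolding product_values_def by (intro CollectI exI[of _ x]) auto
  qed
  then have "(\<Sum>\<^sub>\<infinity>z\<in>G. Max (product_values G n p ?g z))
      = (\<Sum>\<^sub>\<infinity>z\<in>G. Max (product_values K n p f (\<phi> z)))"
    by (intro infsum_cong) simp
  also have "\<dots> = (\<Sum>\<^sub>\<infinity>z\<in>K. Max (product_values K n p f z))"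
    by (rule infsum_reindex_bij_betw[OF bij])
  finally show "sup_convolution_ineq K n p f"
    using ineq unfolding sup_convolution_ineq_def infsum_reindex_bij_betw[OF bij] by simp
qed

lemma summable_on_nonneg_supported:
  assumes "nonneg_supported_on G T g" "finite T"
  shows "g summable_on G"
proof (rule finite_nonzero_values_imp_summable_on)
  show "finite {x \<in> G. g x \<noteq> 0}"
    using assms by (auto simp: nonneg_supported_on_def intro: finite_subset[of _ T])
qed

text \<open>\<open>infsum\<close> takes the default value 0 on families that are not summable, so
  comparing and interchanging sums of maxima rests on this fact. It holds because the maximum has
  finite support.\<close>

lemma summable_on_Max_product_values:
  fixes G :: "'a::comm_monoid_add set"
  assumes "n \<ge> 1" "0 \<in> G"
    and "\<And>j. j \<in> {1..n} \<Longrightarrow> finite (T j)"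
    and "\<And>j. j \<in> {1..n} \<Longrightarrow> nonneg_supported_on G (T j) (f j)"
  shows "(\<lambda>z. Max (product_values G n p f z)) summable_on G"
  by (intro finite_nonzero_values_imp_summable_on finite_support_Max[where T = T]) (use assms in auto)

lemma nonneg_supported_on_section:
  assumes "nonneg_supported_on (G \<times> H) (A \<times> B) f" "t \<in> G"
  shows "nonneg_supported_on H B (\<lambda>x. f (t, x))"
  using assms unfolding nonneg_supported_on_def by blast

lemma nonneg_supported_on_infsum_section:
  assumes "nonneg_supported_on (G \<times> H) (A \<times> B) f"
  shows "nonneg_supported_on G A (\<lambda>t. \<Sum>\<^sub>\<infinity>x\<in>H. f (t, x))"
  unfolding nonneg_supported_on_def
proof (intro conjI ballI impI)
  fix t assume "t \<in> G"
  then show "(\<Sum>\<^sub>\<infinity>x\<in>H. f (t, x)) \<ge> 0"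
    using assms by (intro infsum_nonneg) (auto simp: nonneg_supported_on_def)
next
  fix t assume t: "t \<in> G" "(\<Sum>\<^sub>\<infinity>x\<in>H. f (t, x)) \<noteq> 0"
  then obtain x where "x \<in> H" "f (t, x) \<noteq> 0"
    by (metis infsum_0)
  with t assms show "t \<in> A"
    unfolding nonneg_supported_on_def by blast
qed

text \<open>Fubini turns each total mass over \<open>G \<times> H\<close> into the mass of
  \<open>F j\<close> over \<open>G\<close>. The inequality on \<open>G\<close> applies to these
  \<open>F j\<close>, the inequality on \<open>H\<close> bounds the resulting maxima fibre by fibre,
  and Fubini reassembles the fibres. Finite supports make every maximum attained and every sum
  summable.\<close>

lemma sup_convolution_ineq_on_Times:
  fixes G :: "'a::comm_monoid_add set" and H :: "'b::comm_monoid_add set"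
  assumes n: "n \<ge> 1" and G0: "0 \<in> G" and H0: "0 \<in> H"
    and A: "\<And>j. j \<in> {1..n} \<Longrightarrow> finite (A j)" and B: "\<And>j. j \<in> {1..n} \<Longrightarrow> finite (B j)"
    and G: "sup_convolution_ineq_on G n p A" and H: "sup_convolution_ineq_on H n p B"
  shows "sup_convolution_ineq_on (G \<times> H) n p (\<lambda>j. A j \<times> B j)"
  unfolding sup_convolution_ineq_on_def
proof (intro allI impI)
  fix f :: "nat \<Rightarrow> 'a \<times> 'b \<Rightarrow> real"
  assume "\<forall>j\<in>{1..n}. nonneg_supported_on (G \<times> H) (A j \<times> B j) (f j)"
  then have f: "nonneg_supported_on (G \<times> H) (A j \<times> B j) (f j)" if "j \<in> {1..n}" for j
    using that by blast
  have AB: "finite (A j \<times> B j)" if "j \<in> {1..n}" for j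
    using A B that by blast
  have GH0: "0 \<in> G \<times> H"
    using G0 H0 by (simp add: zero_prod_def)
  let ?M = "\<lambda>z. Max (product_values (G \<times> H) n p f z)"
  define F where "F j t = (\<Sum>\<^sub>\<infinity>x\<in>H. f j (t, x))" for j t
  have F: "nonneg_supported_on G (A j) (F j)" if "j \<in> {1..n}" for j
    unfolding F_def by (rule nonneg_supported_on_infsum_section[OF f[OF that]])
  have M_summable: "?M summable_on G \<times> H"
    using n GH0 AB f by (rule summable_on_Max_product_values)
  have M_summable_section: "(\<lambda>z. ?M (s, z)) summable_on H" if "s \<in> G" for s
    using summable_on_SigmaD1[of "\<lambda>a b. ?M (a, b)" G "\<lambda>_. H"] M_summable that by (simp add: split_def)
  \<comment> \<open>The bound depends on \<open>t\<close> only through its sum \<open>s\<close>, so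
    it survives taking the maximum over all decompositions of \<open>s\<close>.\<close>
  have F_le: "(\<Prod>j=1..n. F j (t j) powr p j) \<le> (\<Sum>\<^sub>\<infinity>z\<in>H. ?M (s, z))"
    if s: "s \<in> G" and t: "\<forall>j\<in>{1..n}. t j \<in> G" "(\<Sum>j=1..n. t j) = s" for s t
  proof -
    let ?g = "\<lambda>j x. f j (t j, x)"
    have g: "nonneg_supported_on H (B j) (?g j)" if "j \<in> {1..n}" for j
      using nonneg_supported_on_section[OF f[OF that]] t(1) that by simp
    have "(\<Prod>j=1..n. F j (t j) powr p j) \<le> (\<Sum>\<^sub>\<infinity>z\<in>H. Max (product_values H n p ?g z))"
      using H g unfolding sup_convolution_ineq_on_def sup_convolution_ineq_def F_def by simp
    also have "\<dots> \<le> (\<Sum>\<^sub>\<infinity>z\<in>H. ?M (s, z))"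
    proof (rule infsum_mono)
      show "(\<lambda>z. Max (product_values H n p ?g z)) summable_on H"
        using n H0 B g by (rule summable_on_Max_product_values)
    next
      fix z assume z: "z \<in> H"
      \<comment> \<open>Pairing a decomposition of \<open>z\<close> with the fixed decomposition
        \<open>t\<close> of \<open>s\<close> gives a decomposition of \<open>(s, z)\<close>; the
        maximum over all of these can only be larger.\<close>
      have "product_values H n p ?g z \<subseteq> product_values (G \<times> H) n p f (s, z)"
      proof
        fix r assume "r \<in> product_values H n p ?g z"
        then obtain x where "\<forall>j\<in>{1..n}. x j \<in> H" "(\<Sum>j=1..n. x j) = z"
            "r = (\<Prod>j=1..n. f j (t j, x j) powr p j)"
          unfolding product_values_def by blast
        with t show "r \<in> product_values (G \<times> H) n p f (s, z)"
          unfolding product_values_def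
          by (intro CollectI exI[of _ "\<lambda>j. (t j, x j)"]) (auto simp: sum_prod)
      qed
      moreover have "product_values H n p ?g z \<noteq> {}"
        using product_values_finite_nonempty(2)[OF n z H0 B g] .
      moreover have "finite (product_values (G \<times> H) n p f (s, z))"
        using product_values_finite_nonempty(1)[OF n _ GH0 AB f] s z by simp
      ultimately show "Max (product_values H n p ?g z) \<le> ?M (s, z)"
        by (rule Max_mono)
    qed (rule M_summable_section[OF s])
    finally show ?thesis .
  qed
  have "(\<Prod>j=1..n. (\<Sum>\<^sub>\<infinity>x\<in>G \<times> H. f j x) powr p j)
      = (\<Prod>j=1..n. (\<Sum>\<^sub>\<infinity>t\<in>G. F j t) powr p j)"
  proof (rule prod.cong[OF refl])
    fix j assume j: "j \<in> {1..n}"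
    have "f j summable_on G \<times> H"
      using f[OF j] AB[OF j] by (rule summable_on_nonneg_supported)
    then have "(\<Sum>\<^sub>\<infinity>t\<in>G. F j t) = (\<Sum>\<^sub>\<infinity>x\<in>G \<times> H. f j x)"
      using infsum_Sigma'_banach[of "\<lambda>a b. f j (a, b)" G "\<lambda>_. H"] by (simp add: F_def split_def)
    then show "(\<Sum>\<^sub>\<infinity>x\<in>G \<times> H. f j x) powr p j = (\<Sum>\<^sub>\<infinity>t\<in>G. F j t) powr p j"
      by simp
  qed
  also have "\<dots> \<le> (\<Sum>\<^sub>\<infinity>s\<in>G. Max (product_values G n p F s))"
    using G F unfolding sup_convolution_ineq_on_def sup_convolution_ineq_def by simp
  also have "\<dots> \<le> (\<Sum>\<^sub>\<infinity>s\<in>G. \<Sum>\<^sub>\<infinity>z\<in>H. ?M (s, z))"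
  proof (rule infsum_mono)
    show "(\<lambda>s. Max (product_values G n p F s)) summable_on G"
      using n G0 A F by (rule summable_on_Max_product_values)
    show "(\<lambda>s. \<Sum>\<^sub>\<infinity>z\<in>H. ?M (s, z)) summable_on G"
      using summable_on_Sigma_banach[of "\<lambda>a b. ?M (a, b)" G "\<lambda>_. H"] M_summable by (simp add: split_def)
  next
    fix s assume s: "s \<in> G"
    \<comment> \<open>The maximum is attained at some decomposition \<open>t\<close> of
      \<open>s\<close>, and the fibre estimate \<open>F_le\<close> is then used for this
      \<open>t\<close>.\<close>
    have "Max (product_values G n p F s) \<in> product_values G n p F s"
      using product_values_finite_nonempty[OF n s G0 A F] by (intro Max_in)
    then obtain t where t: "\<forall>j\<in>{1..n}. t j \<in> G" "(\<Sum>j=1..n. t j) = s"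
        "Max (product_values G n p F s) = (\<Prod>j=1..n. F j (t j) powr p j)"
      unfolding product_values_def by blast
    then show "Max (product_values G n p F s) \<le> (\<Sum>\<^sub>\<infinity>z\<in>H. ?M (s, z))"
      using F_le[OF s t(1,2)] by simp
  qed
  also have "\<dots> = (\<Sum>\<^sub>\<infinity>z\<in>G \<times> H. ?M z)"
    using infsum_Sigma'_banach[of "\<lambda>a b. ?M (a, b)" G "\<lambda>_. H"] M_summable
    by (simp add: split_def)
  finally show "sup_convolution_ineq (G \<times> H) n p f"
    unfolding sup_convolution_ineq_def .
qed

lemma zero_in_int_lattice: "0 \<in> int_lattice d"
  by (simp add: int_lattice_def)

lemma add_in_int_lattice: "x \<in> int_lattice d \<Longrightarrow> y \<in> int_lattice d \<Longrightarrow> x + y \<in> int_lattice d"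
  by (simp add: int_lattice_def)

text \<open>On the one-point group both sides are the same product. Starting the induction here lets
  the step from 0 to 1 be treated like every other.\<close>

lemma sup_convolution_ineq_on_int_lattice_0: "sup_convolution_ineq_on (int_lattice 0) n p T"
proof -
  have 0: "int_lattice 0 = {0}"
    by (auto simp: int_lattice_def)
  have "product_values {0} n p f 0 = {\<Prod>j=1..n. f j 0 powr p j}"
    for f :: "nat \<Rightarrow> (nat \<Rightarrow> int) \<Rightarrow> real"
    unfolding product_values_def by (auto intro!: exI[of _ "\<lambda>_. 0"])
  then show ?thesis
    by (simp add: sup_convolution_ineq_on_def sup_convolution_ineq_def 0)
qed

text \<open>The new coordinate \<open>t\<close> goes to position \<open>d\<close>, where every
  element of \<open>int_lattice d\<close> vanishes; the inverse reads this entry off and resets it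
  to 0.\<close>

lemma bij_betw_int_lattice_Suc:
  "bij_betw (\<lambda>(t, x). x + (\<lambda>i. if i = d then t else 0)) (UNIV \<times> int_lattice d) (int_lattice (Suc d))"
  by (rule bij_betw_byWitness[where f' = "\<lambda>y. (y d, y(d := 0))"])
    (auto simp: int_lattice_def fun_eq_iff le_Suc_eq Suc_le_eq)

lemma sup_convolution_ineq_on_int_lattice:
  assumes n: "n \<ge> 1" and S: "\<And>j. j \<in> {1..n} \<Longrightarrow> finite (S j)"
    and one: "sup_convolution_ineq_on UNIV n p S"
  shows "sup_convolution_ineq_on (int_lattice d) n p (\<lambda>j. cartesian_power (S j) d)"
proof (induction d)
  case 0
  show ?case by (rule sup_convolution_ineq_on_int_lattice_0)
next
  case (Suc d)
  have "sup_convolution_ineq_on (UNIV \<times> int_lattice d) n p (\<lambda>j. S j \<times> cartesian_power (S j) d)"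
    using n _ zero_in_int_lattice S finite_cartesian_power[OF S] one Suc
    by (rule sup_convolution_ineq_on_Times) auto
  then show ?case
  \<comment> \<open>The rotation puts the premise about the inequality on the product first, where
    the chained fact discharges it.\<close>
  proof (rule sup_convolution_ineq_on_bij[OF bij_betw_int_lattice_Suc, rotated 5])
    fix j and u :: "int \<times> (nat \<Rightarrow> int)"
    assume u: "u \<in> UNIV \<times> int_lattice d"
      and "(case u of (t, x) \<Rightarrow> x + (\<lambda>i. if i = d then t else 0)) \<in> cartesian_power (S j) (Suc d)"
    then obtain t x where tx: "u = (t, x)" "x \<in> int_lattice d"
      and in_S: "\<And>i. i < Suc d \<Longrightarrow> x i + (if i = d then t else 0) \<in> S j"
      by (cases u) (auto simp: cartesian_power_def)
    \<comment> \<open>Since \<open>x d = 0\<close>, the entry of the image at position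
      \<open>d\<close> is \<open>t\<close> itself; the entries below \<open>d\<close> are those of
      \<open>x\<close>.\<close>
    have "t \<in> S j"
      using in_S[of d] tx(2) by (simp add: int_lattice_def)
    moreover have "x i \<in> S j" if "i < d" for i
      using in_S[of i] that by simp
    ultimately show "u \<in> S j \<times> cartesian_power (S j) d"
      using tx by (simp add: cartesian_power_def)
  qed (auto simp: zero_prod_def fun_eq_iff zero_in_int_lattice add_in_int_lattice)
qed

text \<open>Evaluation at position 0 is an additive bijection from \<open>int_lattice 1\<close> onto
  \<int>, and it carries the power of \<open>S j\<close> to \<open>S j\<close>.\<close>

lemma sup_convolution_ineq_on_UNIV:
  assumes "sup_convolution_ineq_on (int_lattice 1) n p (\<lambda>j. cartesian_power (S j) 1)"
  shows "sup_convolution_ineq_on UNIV n p S"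
proof (rule sup_convolution_ineq_on_bij[OF _ _ _ _ _ _ assms])
  show "bij_betw (\<lambda>x. x 0) (int_lattice 1) UNIV"
    by (rule bij_betw_byWitness[where f' = "\<lambda>t i. if i = 0 then t else 0"])
      (auto simp: int_lattice_def fun_eq_iff)
qed (auto simp: zero_in_int_lattice add_in_int_lattice cartesian_power_def)

theorem theorem2p1:
  fixes n :: nat and p :: "nat \<Rightarrow> real" and S :: "nat \<Rightarrow> int set"
  assumes "n \<ge> 1"
    and "\<And>j. j \<in> {1..n} \<Longrightarrow> p j > 0"
    and "\<And>j. j \<in> {1..n} \<Longrightarrow> finite (S j) \<and> S j \<noteq> {}"
  shows "(\<forall>d\<ge>1. \<forall>f :: nat \<Rightarrow> (nat \<Rightarrow> int) \<Rightarrow> real.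
            (\<forall>j\<in>{1..n}. nonneg_supported_on (int_lattice d) (cartesian_power (S j) d) (f j)) \<longrightarrow>
            sup_convolution_ineq (int_lattice d) n p f)
     \<longleftrightarrow> (\<forall>f :: nat \<Rightarrow> int \<Rightarrow> real.
            (\<forall>j\<in>{1..n}. nonneg_supported_on UNIV (S j) (f j)) \<longrightarrow>
            sup_convolution_ineq UNIV n p f)"
proof -
  \<comment> \<open>Left to right uses the instance \<open>d = 1\<close> and its identification with
    \<int>; right to left is the induction on the dimension.\<close>
  have "(\<forall>d\<ge>1. sup_convolution_ineq_on (int_lattice d) n p (\<lambda>j. cartesian_power (S j) d))
      \<longleftrightarrow> sup_convolution_ineq_on UNIV n p S"
    using assms(1,3) sup_convolution_ineq_on_int_lattice sup_convolution_ineq_on_UNIV by blast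
  then show ?thesis
    unfolding sup_convolution_ineq_on_def .
qed

end
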